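(* Let $G=(V,E)$ be a finite simple connected regular graph of degree $4$. Then \[ r(G)\geq \frac{8}{5}|V|-1. \]
   Context: For a finite simple graph $G=(V,E)$ with $V=\{v_1,\dots,v_m\}$ and a map $\mathbf{p}:V\to\mathbb{R}^2$, $\mathbf{p}(v_i)=(x_i,y_i)$, the rigidity matrix $R(\mathbf{p})$ is the $|E|\times 2m$ matrix whose row for the edge $e_{ij}=\{v_i,v_j\}$ is the vector $\mathbf{v}_{ij}=(x_i-x_j)\mathbf{b}_{2i-1}+(y_i-y_j)\mathbf{b}_{2i}+(x_j-x_i)\mathbf{b}_{2j-1}+(y_j-y_i)\mathbf{b}_{2j}\in\mathbb{R}^{2m}$, where $\mathbf{b}_k$ are the standard basis vectors. A realization $\mathbf{p}$ is generic if its $2m$ coordinates are algebraically independent over $\mathbb{Q}$. $r(G)$ denotes the rank of $R(\mathbf{p})$ for a generic $\mathbf{p}$ (the rank of the 2-dimensional generic rigidity matroid of $G$); it is independent of the generic $\mathbf{p}$ chosen. *)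

theory Defs
  imports "HOL-Analysis.Analysis" "HOL-Library.Poly_Mapping"
begin

text \<open>
  A graph has the finite type \<open>'v\<close> as its vertex set and is given by its set \<open>E\<close> of edges, each
  edge being an unordered pair of distinct vertices.
\<close>

definition simple_graph :: "'v::finite set set \<Rightarrow> bool"
  where "simple_graph E \<longleftrightarrow> (\<forall>e\<in>E. card e = 2)"

definition connected_graph :: "'v::finite set set \<Rightarrow> bool"
  where "connected_graph E \<longleftrightarrow> (\<forall>u v. (u, v) \<in> {(a, b). {a, b} \<in> E}\<^sup>*)"

definition vertex_degree :: "'v::finite set set \<Rightarrow> 'v \<Rightarrow> nat"
  where "vertex_degree E v = card {e\<in>E. v \<in> e}"

definition regular_graph :: "'v::finite set set \<Rightarrow> nat \<Rightarrow> bool"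
  where "regular_graph E k \<longleftrightarrow> (\<forall>v. vertex_degree E v = k)"

text \<open>
  A polynomial over \<open>\<rat>\<close> in variables indexed by \<open>'i\<close> is a finitely supported map from monomials
  (finitely supported exponent vectors) to coefficients.
\<close>

definition eval_mpoly :: "('i \<Rightarrow> real) \<Rightarrow> (('i \<Rightarrow>\<^sub>0 nat) \<Rightarrow>\<^sub>0 rat) \<Rightarrow> real"
  where "eval_mpoly x P =
    (\<Sum>m\<in>Poly_Mapping.keys P. of_rat (Poly_Mapping.lookup P m) *
      (\<Prod>i\<in>Poly_Mapping.keys m. x i ^ Poly_Mapping.lookup m i))"

definition algebraically_independent :: "('i \<Rightarrow> real) \<Rightarrow> bool"
  where "algebraically_independent x \<longleftrightarrow> (\<forall>P. eval_mpoly x P = 0 \<longrightarrow> P = 0)"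

definition generic :: "('v::finite \<Rightarrow> real^2) \<Rightarrow> bool"
  where "generic p \<longleftrightarrow> algebraically_independent (\<lambda>(v, k). p v $ k)"

text \<open>
  The \<open>2m\<close> columns of the rigidity matrix are indexed by pairs of a vertex and a coordinate.
  The row of an edge is symmetric in its two ends, so it depends on the unordered pair only.
\<close>

definition rigidity_row :: "('v::finite \<Rightarrow> real^2) \<Rightarrow> 'v \<Rightarrow> 'v \<Rightarrow> real^('v \<times> 2)"
  where "rigidity_row p u v =
    (p u $ 1 - p v $ 1) *\<^sub>R axis (u, 1) 1 + (p u $ 2 - p v $ 2) *\<^sub>R axis (u, 2) 1 +
    (p v $ 1 - p u $ 1) *\<^sub>R axis (v, 1) 1 + (p v $ 2 - p u $ 2) *\<^sub>R axis (v, 2) 1"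

lemma rigidity_row_commute: "rigidity_row p u v = rigidity_row p v u"
  by (simp add: rigidity_row_def)

definition rigidity_rows :: "'v::finite set set \<Rightarrow> ('v \<Rightarrow> real^2) \<Rightarrow> (real^('v \<times> 2)) set"
  where "rigidity_rows E p = {rigidity_row p u v | u v. {u, v} \<in> E}"

text \<open>
  The rank of a matrix is the dimension of its set of rows; defining the rank of the rigidity matrix
  this way avoids a type of cardinality \<open>|E|\<close>. The lemma below shows the agreement with \<open>rank\<close> for
  every matrix whose rows are the rows of the edges.
\<close>

definition rigidity_rank :: "'v::finite set set \<Rightarrow> ('v \<Rightarrow> real^2) \<Rightarrow> nat"
  where "rigidity_rank E p = dim (rigidity_rows E p)"

lemma rigidity_rank_eq_rank:
  fixes E :: "'v::finite set set" and a b :: "'e::finite \<Rightarrow> 'v"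
  assumes "bij_betw (\<lambda>e. {a e, b e}) UNIV E"
  shows "rigidity_rank E p = rank (\<chi> e. rigidity_row p (a e) (b e))"
proof -
  have E: "E = range (\<lambda>e. {a e, b e})"
    using assms by (simp add: bij_betw_def)
  have "rows (\<chi> e. rigidity_row p (a e) (b e)) = range (\<lambda>e. rigidity_row p (a e) (b e))"
    by (auto simp: rows_def row_def vec_nth_inverse)
  also have "\<dots> = rigidity_rows E p"
    by (auto simp: rigidity_rows_def E doubleton_eq_iff rigidity_row_commute)
  finally show ?thesis
    by (simp add: rigidity_rank_def row_rank_def)
qed

text \<open>The rank is the same for all generic realizations, so the choice is immaterial.\<close>

definition generic_rank :: "'v::finite set set \<Rightarrow> nat"
  where "generic_rank E = rigidity_rank E (SOME p. generic p)"

end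

theory Submission
  imports Defs
begin

text \<open>
  Call \<open>F\<close> sparse if every set \<open>X\<close> of at least two vertices induces at most \<open>2 |X| - 3\<close> edges of
  \<open>F\<close>, and \<open>X\<close> tight if equality holds. Sparse edge sets have independent rows at generic points
  (Laman), so the rank is at least the size of a maximal sparse \<open>F \<subseteq> E\<close>. By maximality every edge
  of \<open>E\<close> lies in a tight set, and distinct maximal tight sets share at most one vertex; hence
  \<open>|F|\<close> is the sum of \<open>2 |X| - 3\<close> over the maximal tight sets \<open>X\<close>. If the whole vertex set is
  tight, \<open>2 n - 3 \<ge> 8/5 n - 1\<close> because \<open>n \<ge> 5\<close>. Otherwise a discharging argument shows that the
  sum is at least \<open>8/5 n\<close>: each vertex distributes its charge to the sets \<open>X\<close> containing it
  according to its degree inside \<open>X\<close>, and connectivity, parity and 4-regularity ensure that no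
  proper subset is overloaded.
\<close>

section \<open>Rational polynomials and generic points\<close>

text \<open>Padding adds only terms with coefficient \<open>0\<close> and factors with exponent
  \<open>0\<close>; it gives two polynomials a common index set \<open>M\<close>.\<close>

lemma eval_mpoly_eq_sum:
  fixes x :: "'i::finite \<Rightarrow> real"
  assumes "finite M" "Poly_Mapping.keys P \<subseteq> M"
  shows "eval_mpoly x P =
    (\<Sum>m\<in>M. of_rat (Poly_Mapping.lookup P m) * (\<Prod>i\<in>UNIV. x i ^ Poly_Mapping.lookup m i))"
proof -
  have mon: "(\<Prod>i\<in>Poly_Mapping.keys m. x i ^ Poly_Mapping.lookup m i) =
      (\<Prod>i\<in>UNIV. x i ^ Poly_Mapping.lookup m i)" for m
    by (rule prod.mono_neutral_left) (auto simp: in_keys_iff)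
  show ?thesis
    unfolding eval_mpoly_def mon
    using assms by (intro sum.mono_neutral_left) (auto simp: in_keys_iff)
qed

lemma eval_mpoly_zero [simp]: "eval_mpoly x 0 = 0"
  by (simp add: eval_mpoly_def)

lemma eval_mpoly_single:
  fixes x :: "'i::finite \<Rightarrow> real"
  shows "eval_mpoly x (Poly_Mapping.single m c) =
    of_rat c * (\<Prod>i\<in>UNIV. x i ^ Poly_Mapping.lookup m i)"
  by (subst eval_mpoly_eq_sum[of "{m}"]) auto

lemma eval_mpoly_add:
  fixes x :: "'i::finite \<Rightarrow> real"
  shows "eval_mpoly x (P + Q) = eval_mpoly x P + eval_mpoly x Q"
proof -
  let ?M = "Poly_Mapping.keys P \<union> Poly_Mapping.keys Q"
  have "finite ?M" "Poly_Mapping.keys (P + Q) \<subseteq> ?M"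
    by (auto dest: subsetD[OF Poly_Mapping.keys_add])
  then show ?thesis
    by (simp add: eval_mpoly_eq_sum[of ?M] lookup_add of_rat_add distrib_right sum.distrib)
qed

lemma eval_mpoly_sum:
  fixes x :: "'i::finite \<Rightarrow> real"
  shows "eval_mpoly x (\<Sum>a\<in>A. P a) = (\<Sum>a\<in>A. eval_mpoly x (P a))"
  by (induction A rule: infinite_finite_induct) (auto simp: eval_mpoly_add)

text \<open>Each factor is the sum of its monomials (\<open>dec\<close>), so bilinearity reduces the
  claim to a product of two monomials.\<close>

lemma eval_mpoly_mult:
  fixes x :: "'i::finite \<Rightarrow> real"
  shows "eval_mpoly x (P * Q) = eval_mpoly x P * eval_mpoly x Q"
proof -
  let ?s = "\<lambda>R m. Poly_Mapping.single m (Poly_Mapping.lookup R m)"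
  have dec: "R = (\<Sum>m\<in>Poly_Mapping.keys R. ?s R m)" for R :: "('i \<Rightarrow>\<^sub>0 nat) \<Rightarrow>\<^sub>0 rat"
    by (intro poly_mapping_eqI) (simp add: lookup_sum lookup_single when_def in_keys_iff)
  have single: "eval_mpoly x (?s P m * ?s Q n) = eval_mpoly x (?s P m) * eval_mpoly x (?s Q n)" for m n
    by (simp add: mult_single eval_mpoly_single lookup_add power_add prod.distrib of_rat_mult)
  have "P * Q = (\<Sum>m\<in>Poly_Mapping.keys P. \<Sum>n\<in>Poly_Mapping.keys Q. ?s P m * ?s Q n)"
    by (simp only: sum_product[symmetric] dec[symmetric])
  then have "eval_mpoly x (P * Q) =
      (\<Sum>m\<in>Poly_Mapping.keys P. \<Sum>n\<in>Poly_Mapping.keys Q. eval_mpoly x (?s P m) * eval_mpoly x (?s Q n))"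
    by (simp only: eval_mpoly_sum single)
  also have "\<dots> = eval_mpoly x (\<Sum>m\<in>Poly_Mapping.keys P. ?s P m) *
      eval_mpoly x (\<Sum>n\<in>Poly_Mapping.keys Q. ?s Q n)"
    by (simp only: eval_mpoly_sum sum_product)
  finally show ?thesis
    by (simp only: dec[symmetric])
qed

text \<open>A property of functions, so that closure rules handle determinants without writing out a
  formal polynomial.\<close>

definition rational_polynomial :: "(('i \<Rightarrow> real) \<Rightarrow> real) \<Rightarrow> bool"
  where "rational_polynomial f \<longleftrightarrow> (\<exists>P. \<forall>x. f x = eval_mpoly x P)"

lemma rational_polynomial_const:
  "rational_polynomial (\<lambda>x :: 'i::finite \<Rightarrow> real. of_rat c)"
  unfolding rational_polynomial_def
  by (rule exI[of _ "Poly_Mapping.single 0 c"]) (simp add: eval_mpoly_single)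

lemma rational_polynomial_0: "rational_polynomial (\<lambda>x :: 'i::finite \<Rightarrow> real. 0)"
  using rational_polynomial_const[of 0] by simp

lemma rational_polynomial_1: "rational_polynomial (\<lambda>x :: 'i::finite \<Rightarrow> real. 1)"
  using rational_polynomial_const[of 1] by simp

lemma rational_polynomial_var: "rational_polynomial (\<lambda>x :: 'i::finite \<Rightarrow> real. x i)"
proof -
  have "(\<Prod>j\<in>UNIV. x j ^ Poly_Mapping.lookup (Poly_Mapping.single i 1) j) = x i" for x :: "'i \<Rightarrow> real"
    by (subst prod.remove[of _ i]) (auto simp: lookup_single when_def intro!: prod.neutral)
  then show ?thesis
    unfolding rational_polynomial_def
    by (intro exI[of _ "Poly_Mapping.single (Poly_Mapping.single i 1) 1"]) (simp add: eval_mpoly_single)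
qed

lemma rational_polynomial_add:
  fixes f g :: "('i::finite \<Rightarrow> real) \<Rightarrow> real"
  assumes "rational_polynomial f" "rational_polynomial g"
  shows "rational_polynomial (\<lambda>x. f x + g x)"
  using assms unfolding rational_polynomial_def by (metis eval_mpoly_add)

lemma rational_polynomial_mult:
  fixes f g :: "('i::finite \<Rightarrow> real) \<Rightarrow> real"
  assumes "rational_polynomial f" "rational_polynomial g"
  shows "rational_polynomial (\<lambda>x. f x * g x)"
  using assms unfolding rational_polynomial_def by (metis eval_mpoly_mult)

lemma rational_polynomial_diff:
  fixes f g :: "('i::finite \<Rightarrow> real) \<Rightarrow> real"
  assumes "rational_polynomial f" "rational_polynomial g"
  shows "rational_polynomial (\<lambda>x. f x - g x)"
  using rational_polynomial_add[OF assms(1)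
      rational_polynomial_mult[OF rational_polynomial_const[of "-1"] assms(2)]]
  by (simp add: of_rat_minus)

lemma rational_polynomial_sum:
  fixes f :: "'a \<Rightarrow> ('i::finite \<Rightarrow> real) \<Rightarrow> real"
  assumes "\<And>a. a \<in> A \<Longrightarrow> rational_polynomial (f a)"
  shows "rational_polynomial (\<lambda>x. \<Sum>a\<in>A. f a x)"
  using assms
  by (induction A rule: infinite_finite_induct)
    (auto intro: rational_polynomial_add rational_polynomial_0)

lemma rational_polynomial_prod:
  fixes f :: "'a \<Rightarrow> ('i::finite \<Rightarrow> real) \<Rightarrow> real"
  assumes "\<And>a. a \<in> A \<Longrightarrow> rational_polynomial (f a)"
  shows "rational_polynomial (\<lambda>x. \<Prod>a\<in>A. f a x)"
  using assms
  by (induction A rule: infinite_finite_induct)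
    (auto intro: rational_polynomial_mult rational_polynomial_1)

lemma rational_polynomial_det:
  fixes M :: "('i::finite \<Rightarrow> real) \<Rightarrow> real^'n^'n"
  assumes "\<And>i j. rational_polynomial (\<lambda>x. M x $ i $ j)"
  shows "rational_polynomial (\<lambda>x. det (M x))"
proof -
  have "rational_polynomial (\<lambda>x :: 'i \<Rightarrow> real. of_int (sign s) :: real)" for s :: "'n \<Rightarrow> 'n"
    using rational_polynomial_const[of "of_int (sign s)"] by simp
  then show ?thesis
    unfolding det_def
    by (intro rational_polynomial_sum rational_polynomial_mult rational_polynomial_prod assms)
qed

text \<open>If \<open>f x\<close> were \<open>0\<close>, the polynomial representing
  \<open>f\<close> would be zero and \<open>f\<close> would vanish at \<open>y\<close> too.\<close>

lemma algebraically_independent_nonzero: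
  assumes "algebraically_independent x" "rational_polynomial f" "f y \<noteq> 0"
  shows "f x \<noteq> 0"
  using assms unfolding algebraically_independent_def rational_polynomial_def
  by (metis eval_mpoly_zero)

section \<open>Existence of generic realizations\<close>

lemma countable_real_ex_notin: "countable S \<Longrightarrow> \<exists>t::real. t \<notin> S"
  by (metis UNIV_eq_I uncountable_UNIV_real)

text \<open>One coordinate is added at a time: each nontrivial relation excludes only finitely many values
  of the new coordinate, and there are countably many relations.\<close>

lemma ex_independent_monomials:
  fixes A :: "'i::finite set"
  shows "\<exists>x::'i \<Rightarrow> real. \<forall>M c. finite M \<longrightarrow> (\<forall>m\<in>M. \<forall>i. i \<notin> A \<longrightarrow> m i = (0::nat)) \<longrightarrow>
    (\<Sum>m\<in>M. of_rat (c m) * (\<Prod>i\<in>A. x i ^ m i)) = 0 \<longrightarrow> (\<forall>m\<in>M. c m = 0)"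
proof (induction A rule: finite_induct[OF finite])
  case 1
  show ?case
  proof (intro exI allI impI)
    fix M and c :: "('i \<Rightarrow> nat) \<Rightarrow> rat"
    assume "finite M" and M: "\<forall>m\<in>M. \<forall>i. i \<notin> {} \<longrightarrow> m i = 0"
      and s: "(\<Sum>m\<in>M. of_rat (c m) * (\<Prod>i\<in>{}. undefined i ^ m i)) = (0::real)"
    then have "M \<subseteq> {\<lambda>_. 0}"
      by auto
    then have "M = {} \<or> M = {\<lambda>_. 0}"
      by (simp add: subset_singleton_iff)
    then show "\<forall>m\<in>M. c m = 0"
      using s by auto
  qed
next
  case (2 j A)
  then obtain x :: "'i \<Rightarrow> real" where
    x: "\<And>M c. \<lbrakk>finite M; \<forall>m\<in>M. \<forall>i. i \<notin> A \<longrightarrow> m i = 0;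
      (\<Sum>m\<in>M. of_rat (c m) * (\<Prod>i\<in>A. x i ^ m i)) = 0\<rbrakk> \<Longrightarrow> \<forall>m\<in>M. c m = 0"
    by blast
  let ?f = "\<lambda>M c t. \<Sum>m\<in>M. of_rat (c m) * (\<Prod>i\<in>insert j A. (x(j := t)) i ^ m i)"
  let ?Ms = "{M. finite M \<and> (\<forall>m\<in>M. \<forall>i. i \<notin> insert j A \<longrightarrow> m i = (0::nat))}"
  let ?C = "\<lambda>M. {c \<in> PiE M (\<lambda>_. UNIV :: rat set). \<exists>m\<in>M. c m \<noteq> 0}"
  have fin: "finite {t. ?f M c t = 0}" if M: "M \<in> ?Ms" and c: "c \<in> ?C M" for M c
  proof -
    have [simp]: "finite M" using M by simp
    obtain m0 where m0: "m0 \<in> M" "c m0 \<noteq> 0" using c by auto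
    \<comment> \<open>\<open>S k\<close> is the coefficient of \<open>t ^ k\<close> when the
      relation is read as a polynomial in the new coordinate \<open>t\<close>.\<close>
    define g where "g m = of_rat (c m) * (\<Prod>i\<in>A. x i ^ m i)" for m
    define S where "S k = (\<Sum>m\<in>{m\<in>M. m j = k}. g m)" for k
    define N where "N = Max ((\<lambda>m. m j) ` M)"
    have N: "m j \<le> N" if "m \<in> M" for m
      unfolding N_def using that by (intro Max_ge) auto
    have "?f M c t = (\<Sum>k\<le>N. S k * t ^ k)" for t
    proof -
      have "(\<Prod>i\<in>A. (x(j := t)) i ^ m i) = (\<Prod>i\<in>A. x i ^ m i)" for m
        using 2(2) by (intro prod.cong) auto
      then have "(\<Prod>i\<in>insert j A. (x(j := t)) i ^ m i) = t ^ m j * (\<Prod>i\<in>A. x i ^ m i)" for m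
        using 2(2) by (subst prod.insert) simp_all
      then have "?f M c t = (\<Sum>m\<in>M. g m * t ^ m j)"
        by (simp add: g_def algebra_simps)
      also have "\<dots> = (\<Sum>k\<le>N. \<Sum>m\<in>{m\<in>M. m j = k}. g m * t ^ m j)"
        by (rule sum.group[symmetric]) (auto simp: N)
      also have "\<dots> = (\<Sum>k\<le>N. S k * t ^ k)"
        by (simp add: S_def sum_distrib_right)
      finally show ?thesis .
    qed
    moreover have "S (m0 j) \<noteq> 0"
    proof
      assume S0: "S (m0 j) = 0"
      \<comment> \<open>If this coefficient vanished, erasing the common exponent
        \<open>m0 j\<close> of \<open>j\<close> would give a relation over \<open>A\<close> alone.
        Erasing is injective on \<open>?K\<close>, and \<open>?d\<close> restores the exponent to
        look up the coefficient, so the induction hypothesis gives \<open>c m0 = 0\<close>.\<close>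
      let ?K = "{m\<in>M. m j = m0 j}"
      let ?d = "\<lambda>m. c (m(j := m0 j))"
      have inj: "inj_on (\<lambda>m. m(j := 0)) ?K"
        by (rule inj_on_inverseI[of _ "\<lambda>m. m(j := m0 j)"]) auto
      have "(\<Sum>m\<in>(\<lambda>m. m(j := 0)) ` ?K. of_rat (?d m) * (\<Prod>i\<in>A. x i ^ m i)) = S (m0 j)"
        unfolding S_def g_def sum.reindex[OF inj] o_def
      proof (rule sum.cong[OF refl])
        fix m assume "m \<in> ?K"
        then have "m(j := m0 j) = m" by auto
        moreover have "(\<Prod>i\<in>A. x i ^ (m(j := 0)) i) = (\<Prod>i\<in>A. x i ^ m i)"
          using 2(2) by (intro prod.cong) auto
        ultimately show "of_rat (c ((m(j := 0))(j := m0 j))) * (\<Prod>i\<in>A. x i ^ (m(j := 0)) i) =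
            of_rat (c m) * (\<Prod>i\<in>A. x i ^ m i)"
          by simp
      qed
      then have "\<forall>m\<in>(\<lambda>m. m(j := 0)) ` ?K. ?d m = 0"
        using S0 M by (intro x) auto
      then show False using m0 by auto
    qed
    ultimately show ?thesis
      using polyfun_finite_roots[of S N] N[OF m0(1)] by auto
  qed
  have "countable ?Ms"
    by (rule countable_subset[OF _ countable_Collect_finite]) auto
  moreover have "countable (?C M)" if "M \<in> ?Ms" for M
    by (rule countable_subset[OF Collect_restrict countable_PiE]) (use that in simp_all)
  ultimately have "countable (\<Union>M\<in>?Ms. \<Union>c\<in>?C M. {t. ?f M c t = 0})" (is "countable ?bad")
    by (intro countable_UN countable_finite[OF fin])
  from countable_real_ex_notin[OF this] obtain t where t: "t \<notin> ?bad" ..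
  show ?case
  proof (intro exI[of _ "x(j := t)"] allI impI, rule ccontr)
    fix M and c :: "('i \<Rightarrow> nat) \<Rightarrow> rat"
    assume M: "finite M" "\<forall>m\<in>M. \<forall>i. i \<notin> insert j A \<longrightarrow> m i = 0" and s: "?f M c t = 0"
      and n: "\<not> (\<forall>m\<in>M. c m = 0)"
    \<comment> \<open>Only the values of \<open>c\<close> on \<open>M\<close> matter; restriction
      places the coefficients in the countable set \<open>?C M\<close>.\<close>
    have "t \<in> {t. ?f M (restrict c M) t = 0}"
      using s by simp
    moreover have "restrict c M \<in> ?C M"
      using n by auto
    moreover have "M \<in> ?Ms"
      using M by simp
    ultimately have "t \<in> ?bad"
      by (intro UN_I)
    then show False
      using t by contradiction
  qed
qed

lemma ex_algebraically_independent: "\<exists>x::'i::finite \<Rightarrow> real. algebraically_independent x"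
proof -
  obtain x :: "'i \<Rightarrow> real" where
    x: "\<And>M c. \<lbrakk>finite M; (\<Sum>m\<in>M. of_rat (c m) * (\<Prod>i\<in>UNIV. x i ^ m i)) = 0\<rbrakk> \<Longrightarrow> \<forall>m\<in>M. c m = 0"
    using ex_independent_monomials[of "UNIV :: 'i set"] by auto
  have "P = 0" if P: "eval_mpoly x P = 0" for P
  proof -
    have inj: "inj_on Poly_Mapping.lookup (Poly_Mapping.keys P)"
      by (simp add: inj_on_def lookup_inject)
    \<comment> \<open>\<open>the_inv_into\<close> turns an exponent function back into the monomial
      of \<open>P\<close> that it came from.\<close>
    let ?c = "\<lambda>m. Poly_Mapping.lookup P (the_inv_into (Poly_Mapping.keys P) Poly_Mapping.lookup m)"
    have "(\<Sum>m\<in>Poly_Mapping.lookup ` Poly_Mapping.keys P. of_rat (?c m) * (\<Prod>i\<in>UNIV. x i ^ m i)) =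
        eval_mpoly x P"
      by (simp add: sum.reindex[OF inj] the_inv_into_f_f[OF inj]
          eval_mpoly_eq_sum[OF finite_keys order_refl])
    then have "\<forall>m\<in>Poly_Mapping.lookup ` Poly_Mapping.keys P. ?c m = 0"
      using P by (intro x) auto
    then have "Poly_Mapping.lookup P m = 0" for m
      by (auto simp: the_inv_into_f_f[OF inj] in_keys_iff)
    then show ?thesis
      by (intro poly_mapping_eqI) simp
  qed
  then show ?thesis
    unfolding algebraically_independent_def by blast
qed

lemma ex_generic: "\<exists>p::'v::finite \<Rightarrow> real^2. generic p"
proof -
  obtain x :: "'v \<times> 2 \<Rightarrow> real" where x: "algebraically_independent x"
    using ex_algebraically_independent by blast
  then show ?thesis
    unfolding generic_def by (intro exI[of _ "\<lambda>v. \<chi> k. x (v, k)"]) (simp add: split_def)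
qed

section \<open>Independence of rigidity rows\<close>

text \<open>Depends on the unordered edge, with no choice of ends: the summand
  \<open>w = fst i\<close> is \<open>0\<close>, leaving the difference to the other end.\<close>

definition edge_row :: "('v::finite \<Rightarrow> real^2) \<Rightarrow> 'v set \<Rightarrow> real^('v \<times> 2)"
  where "edge_row p e =
    (\<chi> i. if fst i \<in> e then \<Sum>w\<in>e. p (fst i) $ snd i - p w $ snd i else 0)"

lemma edge_row_doubleton:
  assumes "u \<noteq> v"
  shows "edge_row p {u, v} $ (z, k) =
    (if z = u then p u $ k - p v $ k else if z = v then p v $ k - p u $ k else 0)"
  using assms by (simp add: edge_row_def)

lemma edge_row_eq_rigidity_row:
  assumes "u \<noteq> v"
  shows "edge_row p {u, v} = rigidity_row p u v"
proof (rule vec_eq_iff[THEN iffD2], rule allI)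
  fix i :: "'a \<times> 2"
  obtain z k where i: "i = (z, k)" by fastforce
  have "k = 1 \<or> k = 2" by (rule exhaust_2)
  then show "edge_row p {u, v} $ i = rigidity_row p u v $ i"
    using assms by (auto simp: i edge_row_doubleton rigidity_row_def axis_def)
qed

lemma edge_row_cong:
  assumes "\<And>w. w \<in> e \<Longrightarrow> p w = q w"
  shows "edge_row p e = edge_row q e"
  using assms by (auto simp: edge_row_def vec_eq_iff intro!: sum.cong)

text \<open>Independence of the family indexed by edges, so two edges with equal rows count as
  dependent.\<close>

definition edge_independent :: "('v::finite \<Rightarrow> real^2) \<Rightarrow> 'v set set \<Rightarrow> bool"
  where "edge_independent p F \<longleftrightarrow>
    (\<forall>w. (\<Sum>e\<in>F. w e *\<^sub>R edge_row p e) = 0 \<longrightarrow> (\<forall>e\<in>F. w e = 0))"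

lemma edge_independent_imp_independent:
  fixes F :: "'v::finite set set"
  assumes "edge_independent p F"
  shows "inj_on (edge_row p) F" "independent (edge_row p ` F)"
proof -
  show inj: "inj_on (edge_row p) F"
  proof (rule inj_onI, rule ccontr)
    fix d e assume de: "d \<in> F" "e \<in> F" "edge_row p d = edge_row p e" "d \<noteq> e"
    let ?w = "\<lambda>x. if x = d then 1 else if x = e then -1 else (0::real)"
    have "(\<Sum>x\<in>F. ?w x *\<^sub>R edge_row p x) = (\<Sum>x\<in>{d, e}. ?w x *\<^sub>R edge_row p x)"
      using de by (intro sum.mono_neutral_right) auto
    also have "\<dots> = 0"
      using de by simp
    finally have "?w d = 0"
      using assms[unfolded edge_independent_def, rule_format, of ?w d] de(1) by blast
    then show False by simp
  qed
  show "independent (edge_row p ` F)"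
  proof (subst independent_explicit_finite_subsets, intro allI ballI impI)
    fix S u x
    assume S: "S \<subseteq> edge_row p ` F" "finite S" "(\<Sum>v\<in>S. u v *\<^sub>R v) = 0" and x: "x \<in> S"
    let ?w = "\<lambda>e. if edge_row p e \<in> S then u (edge_row p e) else 0"
    have "(\<Sum>e\<in>F. ?w e *\<^sub>R edge_row p e) =
        (\<Sum>v\<in>edge_row p ` F. (if v \<in> S then u v else 0) *\<^sub>R v)"
      by (simp add: sum.reindex[OF inj])
    also have "\<dots> = (\<Sum>v\<in>S. u v *\<^sub>R v)"
      using S(1) by (intro sum.mono_neutral_cong_right) auto
    finally have "\<forall>e\<in>F. ?w e = 0"
      using assms[unfolded edge_independent_def, rule_format, of ?w] S(3) by simp
    moreover obtain e where "e \<in> F" "x = edge_row p e"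
      using S(1) x by blast
    ultimately show "u x = 0"
      using x by auto
  qed
qed

lemma edge_independent_imp_le_rigidity_rank:
  fixes F E :: "'v::finite set set"
  assumes "edge_independent p F" "F \<subseteq> E" "simple_graph E"
  shows "card F \<le> rigidity_rank E p"
proof -
  have "edge_row p ` F \<subseteq> rigidity_rows E p"
  proof
    fix r assume "r \<in> edge_row p ` F"
    then obtain e where e: "e \<in> F" "r = edge_row p e" by blast
    then obtain u v where "e = {u, v}" "u \<noteq> v"
      using assms(2,3) unfolding simple_graph_def card_2_iff by blast
    then show "r \<in> rigidity_rows E p"
      using e assms(2) edge_row_eq_rigidity_row unfolding rigidity_rows_def by blast
  qed
  then have "card (edge_row p ` F) \<le> dim (rigidity_rows E p)"
    using edge_independent_imp_independent(2)[OF assms(1)]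
    by (metis dim_eq_card_independent dim_subset)
  then show ?thesis
    using card_image[OF edge_independent_imp_independent(1)[OF assms(1)]]
    by (simp add: rigidity_rank_def)
qed

section \<open>Transfer of independence to generic realizations\<close>

lemma det_nonzero_iff_rows:
  fixes M :: "real^'n^'n"
  shows "det M \<noteq> 0 \<longleftrightarrow> (\<forall>c. (\<Sum>i\<in>UNIV. c i *\<^sub>R M $ i) = 0 \<longrightarrow> (\<forall>i. c i = 0))"
  unfolding invertible_det_nz[symmetric] invertible_right_inverse
    matrix_right_invertible_independent_rows
  by (simp add: row_def vec_nth_inverse scalar_mult_eq_scaleR)

text \<open>One witness \<open>q\<close>, however special, is enough for all generic
  realizations.\<close>

lemma generic_nonzero:
  assumes "generic p" "rational_polynomial f" "f (\<lambda>(v, k). q v $ k) \<noteq> 0"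
  shows "f (\<lambda>(v, k). p v $ k) \<noteq> 0"
  using assms algebraically_independent_nonzero unfolding generic_def by blast

text \<open>Completing the rows of \<open>F\<close> at \<open>q\<close> by unit vectors to a basis gives a square matrix whose
  determinant is a rational polynomial in the coordinates that does not vanish at \<open>q\<close>.\<close>

lemma edge_independent_generic:
  fixes p q :: "'v::finite \<Rightarrow> real^2"
  assumes "generic p" "edge_independent q F"
  shows "edge_independent p F"
proof -
  note inj = edge_independent_imp_independent(1)[OF assms(2)]
  let ?S = "edge_row q ` F"
  obtain B where B: "?S \<subseteq> B" "B \<subseteq> ?S \<union> Basis" "independent B" "?S \<union> Basis \<subseteq> span B"
    using maximal_independent_subset_extend[of ?S "?S \<union> Basis"]
      edge_independent_imp_independent(2)[OF assms(2)] by blast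
  have "span B = UNIV"
    using B(4) by (metis le_sup_iff span_Basis span_mono span_span top.extremum_uniqueI)
  then have cardB: "card B = CARD('v \<times> 2)"
    using B(3) by (metis dim_UNIV dim_eq_card_independent dim_span DIM_cart DIM_real mult_1_right)
  have finB: "finite B"
    using B(3) by (rule finiteI_independent)
  obtain g :: "'v \<times> 2 \<Rightarrow> real^('v \<times> 2)" where g: "bij_betw g UNIV B"
    using finite_same_card_bij[OF finite finB cardB[symmetric]] by blast
  let ?e = "the_inv_into F (edge_row q)"
  \<comment> \<open>Row \<open>i\<close> is an edge row in the variables \<open>x\<close> if
    \<open>g i\<close> comes from \<open>F\<close>, and the constant unit vector \<open>g i\<close>
    otherwise. At \<open>q\<close> the rows are exactly the basis \<open>B\<close>.\<close>
  define M where "M x = (\<chi> i. if g i \<in> ?S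
      then (\<chi> j. if fst j \<in> ?e (g i) then \<Sum>w\<in>?e (g i). x j - x (w, snd j) else 0) else g i)"
    for x :: "'v \<times> 2 \<Rightarrow> real"
  have M: "M (\<lambda>(v, k). r v $ k) $ i = (if g i \<in> ?S then edge_row r (?e (g i)) else g i)" for r i
    by (simp add: M_def edge_row_def vec_eq_iff)
  have "rational_polynomial (\<lambda>x. det (M x))"
  proof (rule rational_polynomial_det)
    fix i j
    have "g i \<in> B" using g by (auto simp: bij_betw_def)
    then have "g i \<in> Basis" if "g i \<notin> ?S"
      using B(2) that by blast
    then have "g i $ j = 0 \<or> g i $ j = 1" if "g i \<notin> ?S"
      using that by (auto simp: Basis_vec_def axis_def)
    then show "rational_polynomial (\<lambda>x. M x $ i $ j)"
      by (cases "g i \<in> ?S"; cases "fst j \<in> ?e (g i)")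
        (auto simp: M_def intro!: rational_polynomial_sum rational_polynomial_diff
          rational_polynomial_var rational_polynomial_0 rational_polynomial_1)
  qed
  moreover have "det (M (\<lambda>(v, k). q v $ k)) \<noteq> 0"
    unfolding det_nonzero_iff_rows
  proof (intro allI impI)
    fix c i
    assume c: "(\<Sum>i\<in>UNIV. c i *\<^sub>R M (\<lambda>(v, k). q v $ k) $ i) = 0"
    have "M (\<lambda>(v, k). q v $ k) $ i = g i" for i
      by (auto simp: M f_the_inv_into_f[OF inj])
    then have "0 = (\<Sum>i\<in>UNIV. c (the_inv_into UNIV g (g i)) *\<^sub>R g i)"
      using c g by (simp add: the_inv_into_f_f bij_betw_def)
    also have "\<dots> = (\<Sum>b\<in>B. c (the_inv_into UNIV g b) *\<^sub>R b)"
      by (rule sum.reindex_bij_betw[OF g])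
    finally have "\<forall>b\<in>B. c (the_inv_into UNIV g b) = 0"
      using independentD[OF B(3) finB order_refl, of "\<lambda>b. c (the_inv_into UNIV g b)"] by simp
    then show "c i = 0"
      using g by (metis UNIV_I bij_betw_apply bij_betw_imp_inj_on the_inv_into_f_f)
  qed
  ultimately have det: "det (M (\<lambda>(v, k). p v $ k)) \<noteq> 0"
    by (rule generic_nonzero[OF assms(1)])
  show ?thesis
    unfolding edge_independent_def
  proof (intro allI impI ballI)
    fix w e
    assume w: "(\<Sum>e\<in>F. w e *\<^sub>R edge_row p e) = 0" and e: "e \<in> F"
    \<comment> \<open>A dependency \<open>w\<close> among the edge rows at \<open>p\<close>,
      extended by \<open>0\<close> to the unit vectors, is a row dependency of the nonsingular
      matrix at \<open>p\<close>.\<close>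
    define c where "c i = (if g i \<in> ?S then w (?e (g i)) else 0)" for i
    have "(\<Sum>i\<in>UNIV. c i *\<^sub>R M (\<lambda>(v, k). p v $ k) $ i) =
        (\<Sum>i\<in>UNIV. (\<lambda>b. if b \<in> ?S then w (?e b) *\<^sub>R edge_row p (?e b) else 0) (g i))"
      by (rule sum.cong) (auto simp: M c_def)
    also have "\<dots> = (\<Sum>b\<in>B. if b \<in> ?S then w (?e b) *\<^sub>R edge_row p (?e b) else 0)"
      by (rule sum.reindex_bij_betw[OF g])
    also have "\<dots> = (\<Sum>b\<in>?S. w (?e b) *\<^sub>R edge_row p (?e b))"
      using B(1) finB by (intro sum.mono_neutral_cong_right) auto
    also have "\<dots> = 0"
      using w by (simp add: sum.reindex[OF inj] the_inv_into_f_f[OF inj])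
    finally have c: "c i = 0" for i
      using det unfolding det_nonzero_iff_rows by blast
    obtain i where "g i = edge_row q e"
      using g e B(1) unfolding bij_betw_def by (metis image_iff image_subset_iff)
    then show "w e = 0"
      using c[of i] e by (simp add: c_def the_inv_into_f_f[OF inj])
  qed
qed

section \<open>Henneberg extensions\<close>

lemma generic_noncollinear:
  fixes p :: "'v::finite \<Rightarrow> real^2"
  assumes "generic p" "a \<noteq> b" "a \<noteq> c" "b \<noteq> c"
  shows "(p b $ 1 - p a $ 1) * (p c $ 2 - p a $ 2) - (p b $ 2 - p a $ 2) * (p c $ 1 - p a $ 1) \<noteq> 0"
proof -
  let ?f = "\<lambda>x :: 'v \<times> 2 \<Rightarrow> real. (x (b, 1) - x (a, 1)) * (x (c, 2) - x (a, 2)) -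
      (x (b, 2) - x (a, 2)) * (x (c, 1) - x (a, 1))"
  \<comment> \<open>The witness puts \<open>a\<close> at the origin, \<open>b\<close> at
    \<open>(1, 0)\<close> and \<open>c\<close> at \<open>(0, 1)\<close>, where the determinant is
    \<open>1\<close>.\<close>
  let ?q = "\<lambda>v. \<chi> k. if v = b \<and> k = 1 \<or> v = c \<and> k = 2 then 1 else (0::real)"
  have "rational_polynomial ?f"
    by (intro rational_polynomial_diff rational_polynomial_mult rational_polynomial_var)
  moreover have "?f (\<lambda>(v, k). ?q v $ k) \<noteq> 0"
    using assms(2-4) by auto
  ultimately show ?thesis
    using generic_nonzero[OF assms(1), of ?f ?q] by simp
qed

lemma generic_distinct:
  fixes p :: "'v::finite \<Rightarrow> real^2"
  assumes "generic p" "a \<noteq> b"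
  shows "p a $ 1 \<noteq> p b $ 1"
proof -
  let ?f = "\<lambda>x :: 'v \<times> 2 \<Rightarrow> real. x (a, 1) - x (b, 1)"
  let ?q = "\<lambda>v. \<chi> k. if v = a then 1 else (0::real)"
  have "rational_polynomial ?f"
    by (intro rational_polynomial_diff rational_polynomial_var)
  moreover have "?f (\<lambda>(v, k). ?q v $ k) \<noteq> 0"
    using assms(2) by auto
  ultimately show ?thesis
    using generic_nonzero[OF assms(1), of ?f ?q] by simp
qed

lemma sum_star:
  fixes h :: "'v::finite set \<Rightarrow> 'a::comm_monoid_add"
  assumes "\<forall>e\<in>F. v \<notin> e" "v \<notin> N"
  shows "(\<Sum>e\<in>F \<union> (\<lambda>a. {v, a}) ` N. h e) = (\<Sum>e\<in>F. h e) + (\<Sum>a\<in>N. h {v, a})"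
proof -
  have "inj_on (\<lambda>a. {v, a}) N"
    by (auto simp: inj_on_def doubleton_eq_iff)
  moreover have "F \<inter> (\<lambda>a. {v, a}) ` N = {}"
    using assms(1) by auto
  ultimately show ?thesis
    by (subst sum.union_disjoint) (auto simp: sum.reindex)
qed

lemma edge_row_nonincident:
  assumes "v \<notin> e"
  shows "edge_row p e $ (v, k) = 0"
  using assms by (simp add: edge_row_def)

text \<open>Edges of \<open>F\<close> are zero in the two columns of \<open>v\<close>, so these
  columns express equilibrium of the star alone.\<close>

lemma star_stress_at_centre:
  fixes p :: "'v::finite \<Rightarrow> real^2"
  assumes "\<forall>e\<in>F. v \<notin> e" "v \<notin> N"
    and "(\<Sum>e\<in>F \<union> (\<lambda>a. {v, a}) ` N. w e *\<^sub>R edge_row p e) = 0"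
  shows "(\<Sum>a\<in>N. w {v, a} * (p v $ k - p a $ k)) = 0"
proof -
  have "(\<Sum>e\<in>F \<union> (\<lambda>a. {v, a}) ` N. w e * edge_row p e $ (v, k)) = 0"
    using arg_cong[OF assms(3), of "\<lambda>r. r $ (v, k)"] by (simp add: sum_component)
  then have "(\<Sum>e\<in>F. w e * edge_row p e $ (v, k)) + (\<Sum>a\<in>N. w {v, a} * edge_row p {v, a} $ (v, k)) = 0"
    by (simp add: sum_star[OF assms(1,2)])
  moreover have "(\<Sum>e\<in>F. w e * edge_row p e $ (v, k)) = 0"
    using assms(1) by (intro sum.neutral) (auto simp: edge_row_nonincident)
  moreover have "(\<Sum>a\<in>N. w {v, a} * edge_row p {v, a} $ (v, k)) = (\<Sum>a\<in>N. w {v, a} * (p v $ k - p a $ k))"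
    using assms(2) by (intro sum.cong refl, subst edge_row_doubleton) auto
  ultimately show ?thesis
    by simp
qed

lemma linear_system_2_trivial:
  fixes s t :: real
  assumes "s * x1 + t * y1 = 0" "s * x2 + t * y2 = 0" "x1 * y2 - x2 * y1 \<noteq> 0"
  shows "s = 0" "t = 0"
proof -
  have "s * (x1 * y2 - x2 * y1) = 0" "t * (x1 * y2 - x2 * y1) = 0"
    using assms(1,2) by algebra+
  then show "s = 0" "t = 0"
    using assms(3) by auto
qed

text \<open>The at most two edge directions at \<open>v\<close> are linearly independent, so
  equilibrium at \<open>v\<close> kills the stress on the star; what remains is a stress of
  \<open>F\<close>.\<close>

lemma edge_independent_0_extension:
  fixes p :: "'v::finite \<Rightarrow> real^2"
  assumes "generic p" "edge_independent p F" "\<forall>e\<in>F. v \<notin> e" "v \<notin> N" "card N \<le> 2"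
  shows "edge_independent p (F \<union> (\<lambda>a. {v, a}) ` N)"
  unfolding edge_independent_def
proof (intro allI impI)
  fix w
  assume w: "(\<Sum>e\<in>F \<union> (\<lambda>a. {v, a}) ` N. w e *\<^sub>R edge_row p e) = 0"
  note centre = star_stress_at_centre[OF assms(3,4) w]
  consider "N = {}" | a where "N = {a}" | a b where "N = {a, b}" "a \<noteq> b"
  proof -
    have "card N = 0 \<or> card N = 1 \<or> card N = 2"
      using assms(5) by linarith
    then show thesis
      using that by (auto simp: card_1_singleton_iff card_2_iff)
  qed
  then have N: "\<forall>a\<in>N. w {v, a} = 0"
  proof cases
    case (2 a)
    then show ?thesis
      using centre[of 1] generic_distinct[OF assms(1), of v a] assms(4) by auto
  next
    case (3 a b)
    have "(p v $ 1 - p a $ 1) * (p v $ 2 - p b $ 2) - (p v $ 2 - p a $ 2) * (p v $ 1 - p b $ 1) \<noteq> 0"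
      using generic_noncollinear[OF assms(1), of v a b] 3 assms(4) by (auto simp: algebra_simps)
    moreover have "w {v, a} * (p v $ k - p a $ k) + w {v, b} * (p v $ k - p b $ k) = 0" for k
      using centre[of k] 3 by simp
    ultimately have "w {v, a} = 0" "w {v, b} = 0"
      using linear_system_2_trivial by blast+
    then show ?thesis
      using 3 by simp
  qed auto
  then have "(\<Sum>e\<in>F. w e *\<^sub>R edge_row p e) = 0"
    using w by (simp add: sum_star[OF assms(3,4)])
  then show "\<forall>e\<in>F \<union> (\<lambda>a. {v, a}) ` N. w e = 0"
    using assms(2) N unfolding edge_independent_def by blast
qed

text \<open>With \<open>v\<close> at the midpoint of \<open>a\<close> and \<open>b\<close>, a stress vanishes on \<open>{v, c}\<close> and takes equal
  values on \<open>{v, a}\<close> and \<open>{v, b}\<close>, so it is a stress of the graph with \<open>{a, b}\<close> in place of \<open>v\<close>.\<close>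

lemma edge_independent_1_extension:
  fixes p :: "'v::finite \<Rightarrow> real^2"
  assumes "generic p" "edge_independent p (insert {a, b} F)" "{a, b} \<notin> F" "\<forall>e\<in>F. v \<notin> e"
    and dist: "distinct [v, a, b, c]"
  shows "edge_independent p (F \<union> (\<lambda>x. {v, x}) ` {a, b, c})"
proof (rule edge_independent_generic[OF assms(1)])
  define q where "q = p(v := (1/2) *\<^sub>R (p a + p b))"
  show "edge_independent q (F \<union> (\<lambda>x. {v, x}) ` {a, b, c})"
    unfolding edge_independent_def
  proof (intro allI impI)
    fix w
    assume w: "(\<Sum>e\<in>F \<union> (\<lambda>x. {v, x}) ` {a, b, c}. w e *\<^sub>R edge_row q e) = 0"
    have v: "v \<notin> {a, b, c}" using dist by auto
    have q: "q v $ k = (p a $ k + p b $ k) / 2" "q a = p a" "q b = p b" "q c = p c" for k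
      using dist by (auto simp: q_def)
    \<comment> \<open>At the midpoint, \<open>q v - p a\<close> and \<open>q v - p b\<close> are
      opposite halves of \<open>p b - p a\<close>, so the edges to \<open>a\<close> and
      \<open>b\<close> jointly pull with \<open>s\<close> times that vector.\<close>
    define s where "s = (w {v, a} - w {v, b}) / 2"
    have "s * (p b $ k - p a $ k) + w {v, c} * (q v $ k - p c $ k) = 0" for k
      using star_stress_at_centre[OF assms(4) v w, of k] dist
      by (simp add: q s_def field_simps)
    moreover have "(p b $ 1 - p a $ 1) * (q v $ 2 - p c $ 2) - (p b $ 2 - p a $ 2) * (q v $ 1 - p c $ 1) \<noteq> 0"
      using generic_noncollinear[OF assms(1), of a b c] dist by (auto simp: q field_simps)
    ultimately have "s = 0" and wc: "w {v, c} = 0"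
      using linear_system_2_trivial by blast+
    then have wb: "w {v, b} = w {v, a}"
      by (simp add: s_def)
    \<comment> \<open>The halved weight reflects that the rows of \<open>{v, a}\<close> and
      \<open>{v, b}\<close> at \<open>q\<close> add up to half the row of \<open>{a, b}\<close> at
      \<open>p\<close>: they cancel in the columns of \<open>v\<close>.\<close>
    define w' where "w' = w({a, b} := w {v, a} / 2)"
    have F: "(\<Sum>e\<in>F. w e *\<^sub>R edge_row q e) = (\<Sum>e\<in>F. w' e *\<^sub>R edge_row p e)"
    proof (rule sum.cong[OF refl])
      fix e assume "e \<in> F"
      then have "e \<noteq> {a, b}" "edge_row q e = edge_row p e"
        using assms(3,4) by (auto intro!: edge_row_cong simp: q_def)
      then show "w e *\<^sub>R edge_row q e = w' e *\<^sub>R edge_row p e"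
        by (simp add: w'_def)
    qed
    have ab: "w {v, a} *\<^sub>R edge_row q {v, a} + w {v, a} *\<^sub>R edge_row q {v, b} =
        (w {v, a} / 2) *\<^sub>R edge_row p {a, b}"
    proof (rule vec_eq_iff[THEN iffD2], rule allI)
      fix i :: "'v \<times> 2"
      obtain z k where "i = (z, k)" by fastforce
      then show "(w {v, a} *\<^sub>R edge_row q {v, a} + w {v, a} *\<^sub>R edge_row q {v, b}) $ i =
          ((w {v, a} / 2) *\<^sub>R edge_row p {a, b}) $ i"
        using dist by (auto simp: edge_row_doubleton q field_simps)
    qed
    have "(\<Sum>e\<in>insert {a, b} F. w' e *\<^sub>R edge_row p e) = 0"
      using w dist assms(3)
      by (simp only: sum_star[OF assms(4) v] F) (simp add: wc wb ab w'_def add.commute)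
    then have "\<forall>e\<in>insert {a, b} F. w' e = 0"
      using assms(2) unfolding edge_independent_def by blast
    then have "w {v, a} = 0" "\<forall>e\<in>F. w e = 0"
      using assms(3) by (auto simp: w'_def split: if_splits)
    then show "\<forall>e\<in>F \<union> (\<lambda>x. {v, x}) ` {a, b, c}. w e = 0"
      using wc wb by auto
  qed
qed

section \<open>Laman sparsity\<close>

definition induced_edges :: "'v set set \<Rightarrow> 'v set \<Rightarrow> 'v set set"
  where "induced_edges F X = {e\<in>F. e \<subseteq> X}"

definition laman_sparse :: "'v::finite set set \<Rightarrow> bool"
  where "laman_sparse F \<longleftrightarrow> simple_graph F \<and>
    (\<forall>X. 2 \<le> card X \<longrightarrow> card (induced_edges F X) + 3 \<le> 2 * card X)"

definition tight :: "'v::finite set set \<Rightarrow> 'v set \<Rightarrow> bool"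
  where "tight F X \<longleftrightarrow> 2 \<le> card X \<and> card (induced_edges F X) + 3 = 2 * card X"

lemma laman_sparse_card_le:
  "laman_sparse F \<Longrightarrow> 2 \<le> card X \<Longrightarrow> card (induced_edges F X) + 3 \<le> 2 * card X"
  by (simp add: laman_sparse_def)

lemma laman_sparse_subset:
  fixes F :: "'v::finite set set"
  assumes "laman_sparse F" "G \<subseteq> F"
  shows "laman_sparse G"
proof -
  have "card (induced_edges G X) \<le> card (induced_edges F X)" for X
    using assms(2) by (intro card_mono) (auto simp: induced_edges_def)
  then show ?thesis
    using assms unfolding laman_sparse_def simple_graph_def by (meson add_le_mono1 le_trans subsetD)
qed

text \<open>Cardinality is modular and the number of induced edges supermodular, so the sparsity
  bounds on union and intersection must both be attained.\<close>

lemma tight_Un: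
  fixes F :: "'v::finite set set"
  assumes "laman_sparse F" "tight F X" "tight F Y" "2 \<le> card (X \<inter> Y)"
  shows "tight F (X \<union> Y)"
proof -
  have "card (X \<union> Y) + card (X \<inter> Y) = card X + card Y"
    by (simp add: card_Un_Int[of X Y])
  moreover have "card (X \<inter> Y) \<le> card (X \<union> Y)"
    by (rule card_mono) auto
  moreover have "card (induced_edges F X) + card (induced_edges F Y) =
      card (induced_edges F X \<union> induced_edges F Y) + card (induced_edges F X \<inter> induced_edges F Y)"
    by (rule card_Un_Int) auto
  moreover have "card (induced_edges F X \<union> induced_edges F Y) \<le> card (induced_edges F (X \<union> Y))"
    by (rule card_mono) (auto simp: induced_edges_def)
  moreover have "card (induced_edges F X \<inter> induced_edges F Y) \<le> card (induced_edges F (X \<inter> Y))"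
    by (rule card_mono) (auto simp: induced_edges_def)
  ultimately show ?thesis
    using assms laman_sparse_card_le[OF assms(1), of "X \<union> Y"] laman_sparse_card_le[OF assms(1,4)]
    unfolding tight_def by linarith
qed

lemma laman_sparse_insert:
  fixes F :: "'v::finite set set"
  assumes "laman_sparse F" "card e = 2" "\<And>X. tight F X \<Longrightarrow> \<not> e \<subseteq> X"
  shows "e \<notin> F" "laman_sparse (insert e F)"
proof -
  show e: "e \<notin> F"
  proof
    assume "e \<in> F"
    then have "card {e} \<le> card (induced_edges F e)"
      by (intro card_mono) (auto simp: induced_edges_def)
    \<comment> \<open>A single edge on two vertices attains the bound:
      \<open>1 + 3 = 2 * 2\<close>.\<close>
    then have "tight F e"
      using laman_sparse_card_le[OF assms(1), of e] assms(2) by (simp add: tight_def)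
    then show False
      using assms(3) by blast
  qed
  show "laman_sparse (insert e F)"
    unfolding laman_sparse_def
  proof (intro conjI allI impI)
    show "simple_graph (insert e F)"
      using assms by (simp add: laman_sparse_def simple_graph_def)
    fix X :: "'v set"
    assume X: "2 \<le> card X"
    show "card (induced_edges (insert e F) X) + 3 \<le> 2 * card X"
    proof (cases "e \<subseteq> X")
      case True
      then have "induced_edges (insert e F) X = insert e (induced_edges F X)"
        by (auto simp: induced_edges_def)
      moreover have "\<not> tight F X"
        using True assms(3) by blast
      ultimately show ?thesis
        using e X laman_sparse_card_le[OF assms(1) X] by (simp add: tight_def induced_edges_def)
    next
      case False
      then have "induced_edges (insert e F) X = induced_edges F X"
        by (auto simp: induced_edges_def)
      then show ?thesis
        using laman_sparse_card_le[OF assms(1) X] by simp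
    qed
  qed
qed

lemma induced_edges_disjoint:
  fixes F :: "'v::finite set set"
  assumes "simple_graph F" "card (X \<inter> Y) < 2"
  shows "induced_edges F X \<inter> induced_edges F Y = {}"
proof -
  have False if "e \<in> F" "e \<subseteq> X" "e \<subseteq> Y" for e
  proof -
    have "card e \<le> card (X \<inter> Y)"
      using that by (intro card_mono) auto
    then show False
      using assms that(1) by (simp add: simple_graph_def)
  qed
  then show ?thesis
    by (auto simp: induced_edges_def)
qed

lemma handshake:
  fixes F :: "'v::finite set set"
  assumes "simple_graph F" "\<And>e. e \<in> F \<Longrightarrow> e \<subseteq> X"
  shows "(\<Sum>v\<in>X. card {e\<in>F. v \<in> e}) = 2 * card F"
proof (rule sum_multicount)
  have "{v\<in>X. v \<in> e} = e" if "e \<in> F" for e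
    using assms(2)[OF that] by auto
  then show "\<forall>e\<in>F. card {v\<in>X. v \<in> e} = 2"
    using assms(1) by (simp add: simple_graph_def)
qed auto

lemma star_eq_image:
  assumes "simple_graph F"
  shows "{e\<in>F. v \<in> e} = (\<lambda>a. {v, a}) ` {a. {v, a} \<in> F}"
proof -
  have "e \<in> (\<lambda>a. {v, a}) ` {a. {v, a} \<in> F}" if "e \<in> F" "v \<in> e" for e
  proof -
    have "card e = 2"
      using assms that(1) by (simp add: simple_graph_def)
    then obtain x y where "e = {x, y}"
      by (meson card_2_iff)
    then have "e = {v, x} \<or> e = {v, y}"
      using that(2) by auto
    then show ?thesis
      using that(1) by blast
  qed
  then show ?thesis
    by auto
qed

lemma card_star:
  assumes "simple_graph F"
  shows "card {e\<in>F. v \<in> e} = card {a. {v, a} \<in> F}"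
  unfolding star_eq_image[OF assms]
  by (rule card_image) (auto simp: inj_on_def doubleton_eq_iff)

lemma simple_graph_irrefl:
  assumes "simple_graph F"
  shows "{v, v} \<notin> F"
  using assms by (auto simp: simple_graph_def)

text \<open>The degrees sum to \<open>2 * card F\<close>, at most
  \<open>4 * card (\<Union>F) - 6\<close>, so the average degree is below \<open>4\<close>.\<close>

lemma laman_sparse_ex_low_degree:
  fixes F :: "'v::finite set set"
  assumes "laman_sparse F" "F \<noteq> {}"
  shows "\<exists>v\<in>\<Union>F. card {e\<in>F. v \<in> e} \<le> 3"
proof (rule ccontr)
  assume "\<not> ?thesis"
  then have ge: "4 \<le> card {e\<in>F. v \<in> e}" if "v \<in> \<Union>F" for v
    using that by force
  obtain e where e: "e \<in> F" using assms(2) by blast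
  have "card e \<le> card (\<Union>F)"
    using e by (intro card_mono) auto
  moreover have "card e = 2"
    using e assms(1) by (simp add: laman_sparse_def simple_graph_def)
  moreover have "induced_edges F (\<Union>F) = F"
    by (auto simp: induced_edges_def)
  ultimately have "card F + 3 \<le> 2 * card (\<Union>F)"
    using laman_sparse_card_le[OF assms(1), of "\<Union>F"] by simp
  moreover have "4 * card (\<Union>F) \<le> (\<Sum>v\<in>\<Union>F. card {e\<in>F. v \<in> e})"
    using sum_mono[of "\<Union>F" "\<lambda>_. 4", OF ge] by (simp add: mult.commute)
  moreover have "(\<Sum>v\<in>\<Union>F. card {e\<in>F. v \<in> e}) = 2 * card F"
    using assms(1) by (intro handshake) (auto simp: laman_sparse_def)
  ultimately show False
    by linarith
qed

text \<open>If no pair of neighbours could be joined, three tight sets through the pairs would have a tight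
  union containing all three neighbours, and adding \<open>v\<close> to it would violate sparsity.\<close>

lemma laman_sparse_degree_3_reduction:
  fixes F :: "'v::finite set set"
  assumes "laman_sparse F" "{a. {v, a} \<in> F} = {a, b, c}" "a \<noteq> b" "a \<noteq> c" "b \<noteq> c"
  obtains x y z where "{x, y, z} = {a, b, c}" "x \<noteq> y" "x \<noteq> z" "y \<noteq> z"
    "{x, y} \<notin> {e\<in>F. v \<notin> e}" "laman_sparse (insert {x, y} {e\<in>F. v \<notin> e})"
proof (rule ccontr)
  assume no: "\<not> thesis"
  note witness = that
  let ?F = "{e\<in>F. v \<notin> e}"
  have sp: "laman_sparse ?F"
    by (rule laman_sparse_subset[OF assms(1)]) auto
  have simple: "simple_graph F"
    using assms(1) by (simp add: laman_sparse_def)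
  have v: "v \<notin> {a, b, c}"
    using simple_graph_irrefl[OF simple] assms(2) by blast
  have star: "card {e\<in>F. v \<in> e} = 3"
    using card_star[OF simple, of v] assms(2-5) by simp
  have ex: "\<exists>X. tight ?F X \<and> {x, y} \<subseteq> X"
    if "{x, y, z} = {a, b, c}" "x \<noteq> y" "x \<noteq> z" "y \<noteq> z" for x y z
  proof (rule ccontr)
    assume n: "\<not> ?thesis"
    have "card {x, y} = 2" using that by simp
    from laman_sparse_insert[OF sp this] n witness[OF that] no show False
      by blast
  qed
  \<comment> \<open>Otherwise deleting \<open>v\<close> from \<open>X\<close> would lose a vertex
    but no edge of \<open>?F\<close>, breaking sparsity.\<close>
  have notin: "v \<notin> X" if "tight ?F X" "{a, b} \<subseteq> X" for X
  proof
    assume "v \<in> X"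
    have "card {a, b} \<le> card (X - {v})"
      using that(2) v by (intro card_mono) auto
    then have "card (induced_edges ?F (X - {v})) + 3 \<le> 2 * card (X - {v})"
      using assms(3) by (intro laman_sparse_card_le[OF sp]) simp
    moreover have "induced_edges ?F (X - {v}) = induced_edges ?F X"
      by (auto simp: induced_edges_def)
    moreover have "card X = card (X - {v}) + 1"
      using card_Suc_Diff1[OF finite \<open>v \<in> X\<close>] by simp
    ultimately show False
      using that(1) by (simp add: tight_def)
  qed
  \<comment> \<open>Restoring \<open>v\<close> adds one vertex and three edges, one more edge than
    the tight set \<open>X\<close> leaves room for.\<close>
  have no3: False if X: "tight ?F X" "{a, b, c} \<subseteq> X" for X
  proof -
    have "v \<notin> X" using notin X by blast
    have sub: "{e\<in>F. v \<in> e} \<subseteq> induced_edges F (insert v X)"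
    proof
      fix e assume e: "e \<in> {e\<in>F. v \<in> e}"
      then obtain x where "e = {v, x}" "x \<in> {a, b, c}"
        unfolding star_eq_image[OF simple] assms(2) by blast
      then show "e \<in> induced_edges F (insert v X)"
        using e X(2) by (auto simp: induced_edges_def)
    qed
    have "card (induced_edges ?F X \<union> {e\<in>F. v \<in> e}) = card (induced_edges ?F X) + 3"
      unfolding star[symmetric] by (rule card_Un_disjoint) (auto simp: induced_edges_def)
    moreover have "card (induced_edges ?F X \<union> {e\<in>F. v \<in> e}) \<le> card (induced_edges F (insert v X))"
      using sub by (intro card_mono) (auto simp: induced_edges_def)
    moreover have "card (induced_edges F (insert v X)) + 3 \<le> 2 * card (insert v X)"
      using X(1) \<open>v \<notin> X\<close> by (intro laman_sparse_card_le[OF assms(1)]) (simp add: tight_def)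
    ultimately show False
      using X(1) \<open>v \<notin> X\<close> by (simp add: tight_def)
  qed
  obtain X Y Z where X: "tight ?F X" "{a, b} \<subseteq> X" and Y: "tight ?F Y" "{b, c} \<subseteq> Y"
    and Z: "tight ?F Z" "{c, a} \<subseteq> Z"
    using ex[of a b c] ex[of b c a] ex[of c a b] assms(3-5) by (auto simp: insert_commute)
  \<comment> \<open>With two common vertices the union would be tight by \<open>tight_Un\<close> and
    contain all three neighbours.\<close>
  have small: "card (S \<inter> T) < 2"
    if "tight ?F S" "tight ?F T" "{a, b, c} \<subseteq> S \<union> T" for S T
    using no3[OF tight_Un[OF sp that(1,2)]] that(3) by (meson not_less)
  have XY: "X \<inter> Y = {b}" and YZ: "Y \<inter> Z = {c}" and XZ: "X \<inter> Z = {a}"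
  proof -
    have single: "S = {s}" if "card S < 2" "s \<in> S" for S :: "'v set" and s
    proof -
      have "card S \<noteq> 0" using that(2) by auto
      then have "card S = 1" using that(1) by linarith
      then show ?thesis using that(2) by (auto simp: card_1_singleton_iff)
    qed
    show "X \<inter> Y = {b}" "Y \<inter> Z = {c}" "X \<inter> Z = {a}"
      using X Y Z by (auto intro!: single small)
  qed
  have disj: "induced_edges ?F S \<inter> induced_edges ?F T = {}" if "S \<inter> T = {s}" for S T s
    using sp that by (intro induced_edges_disjoint) (auto simp: laman_sparse_def)
  \<comment> \<open>The three sets meet pairwise in single distinct vertices. With \<open>n\<close>
    the sum of their sizes, \<open>?U\<close> has \<open>n - 3\<close> vertices and at least
    \<open>2 * n - 9 = 2 * (n - 3) - 3\<close> edges, hence is tight.\<close>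
  let ?U = "X \<union> Y \<union> Z"
  have "card (X \<union> Y) + 1 = card X + card Y"
    using card_Un_Int[of X Y] XY by simp
  moreover have "card ?U + 2 = card (X \<union> Y) + card Z"
  proof -
    have "(X \<union> Y) \<inter> Z = {a, c}" using XZ YZ by auto
    then show ?thesis
      using card_Un_Int[of "X \<union> Y" Z] assms(4) by simp
  qed
  moreover have "card (induced_edges ?F X \<union> induced_edges ?F Y \<union> induced_edges ?F Z) =
      card (induced_edges ?F X) + card (induced_edges ?F Y) + card (induced_edges ?F Z)"
    using disj[OF XY] disj[OF YZ] disj[OF XZ] by (simp add: card_Un_disjoint Int_Un_distrib2)
  moreover have "card (induced_edges ?F X \<union> induced_edges ?F Y \<union> induced_edges ?F Z) \<le>
      card (induced_edges ?F ?U)"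
    by (rule card_mono) (auto simp: induced_edges_def)
  moreover have "2 \<le> card ?U"
    using X(1) card_mono[of ?U X] by (simp add: tight_def le_supI1)
  moreover have "card (induced_edges ?F ?U) + 3 \<le> 2 * card ?U"
    using \<open>2 \<le> card ?U\<close> by (rule laman_sparse_card_le[OF sp])
  ultimately have "tight ?F ?U"
    using X(1) Y(1) Z(1) unfolding tight_def by linarith
  then show False
    using no3 X(2) Y(2) by blast
qed

text \<open>The nontrivial half of Laman's theorem, by Henneberg's construction.\<close>

lemma laman_sparse_imp_edge_independent:
  fixes F :: "'v::finite set set"
  assumes "generic p" "laman_sparse F"
  shows "edge_independent p F"
  using assms(2)
proof (induction "card (\<Union>F)" arbitrary: F rule: less_induct)
  case less
  show ?case
  proof (cases "F = {}")
    case True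
    then show ?thesis by (simp add: edge_independent_def)
  next
    case False
    obtain v where v: "v \<in> \<Union>F" "card {e\<in>F. v \<in> e} \<le> 3"
      using laman_sparse_ex_low_degree[OF less.prems False] by blast
    have simple: "simple_graph F"
      using less.prems by (simp add: laman_sparse_def)
    let ?F = "{e\<in>F. v \<notin> e}" and ?N = "{a. {v, a} \<in> F}"
    have F: "F = ?F \<union> (\<lambda>a. {v, a}) ` ?N"
      using star_eq_image[OF simple, of v] by blast
    have vN: "v \<notin> ?N"
      using simple_graph_irrefl[OF simple] by blast
    \<comment> \<open>The induction counts covered vertices: both reductions remove
      \<open>v\<close>, and an added edge joins neighbours of \<open>v\<close>, which are already
      covered.\<close>
    have IH: "edge_independent p G" if "laman_sparse G" "\<Union>G \<subseteq> \<Union>F - {v}" for G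
    proof (rule less.hyps[OF psubset_card_mono that(1)])
      show "\<Union>G \<subset> \<Union>F"
        using that(2) v(1) by blast
    qed simp
    show ?thesis
    proof (cases "card ?N \<le> 2")
      case True
      have "edge_independent p ?F"
        by (rule IH[OF laman_sparse_subset[OF less.prems]]) auto
      then have "edge_independent p (?F \<union> (\<lambda>a. {v, a}) ` ?N)"
        by (rule edge_independent_0_extension[OF assms(1) _ _ vN True]) simp
      then show ?thesis
        using F by simp
    next
      case False
      then have "card ?N = 3"
        using v(2) card_star[OF simple, of v] by simp
      then obtain a b c where N: "?N = {a, b, c}" "a \<noteq> b" "a \<noteq> c" "b \<noteq> c"
        unfolding card_3_iff by blast
      obtain x y z where xyz: "{x, y, z} = {a, b, c}" "x \<noteq> y" "x \<noteq> z" "y \<noteq> z"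
        "{x, y} \<notin> ?F" "laman_sparse (insert {x, y} ?F)"
        using laman_sparse_degree_3_reduction[OF less.prems N] .
      have "{x, y, z} \<subseteq> \<Union>F - {v}"
        unfolding xyz(1) N(1)[symmetric] using vN by auto
      then have "edge_independent p (insert {x, y} ?F)"
        by (intro IH[OF xyz(6)]) auto
      moreover have "distinct [v, x, y, z]"
        using xyz vN N(1) by auto
      ultimately have "edge_independent p (?F \<union> (\<lambda>a. {v, a}) ` {x, y, z})"
        by (intro edge_independent_1_extension[OF assms(1) _ xyz(5)]) auto
      then show ?thesis
        using F xyz(1) N(1) by simp
    qed
  qed
qed

section \<open>A cover by maximal tight sets\<close>

lemma ex_tight_cover:
  fixes E :: "'v::finite set set"
  assumes "simple_graph E"
  obtains F \<T> where "F \<subseteq> E" "laman_sparse F" "\<And>X. X \<in> \<T> \<Longrightarrow> 2 \<le> card X"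
    "\<And>e. e \<in> E \<Longrightarrow> \<exists>X\<in>\<T>. e \<subseteq> X"
    "\<And>X Y. X \<in> \<T> \<Longrightarrow> Y \<in> \<T> \<Longrightarrow> X \<noteq> Y \<Longrightarrow> card (X \<inter> Y) < 2"
    "(\<Sum>X\<in>\<T>. 2 * card X - 3) \<le> card F"
proof -
  have "laman_sparse ({} :: 'v set set)"
    by (auto simp: laman_sparse_def simple_graph_def induced_edges_def)
  then have "{} \<in> {F. F \<subseteq> E \<and> laman_sparse F}"
    by simp
  then obtain F where F: "F \<subseteq> E" "laman_sparse F" and
    max: "\<And>G. \<lbrakk>G \<subseteq> E; laman_sparse G; F \<subseteq> G\<rbrakk> \<Longrightarrow> F = G"
    using finite_has_maximal2[of "{F. F \<subseteq> E \<and> laman_sparse F}" "{}"] by auto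
  define \<T> where "\<T> = {X. tight F X \<and> (\<forall>Y. tight F Y \<longrightarrow> X \<subseteq> Y \<longrightarrow> X = Y)}"
  have small: "card (X \<inter> Y) < 2" if "X \<in> \<T>" "Y \<in> \<T>" "X \<noteq> Y" for X Y
  proof (rule ccontr)
    assume "\<not> ?thesis"
    then have "tight F (X \<union> Y)"
      using that by (intro tight_Un[OF F(2)]) (auto simp: \<T>_def)
    then have "X = X \<union> Y" "Y = X \<union> Y"
      using that unfolding \<T>_def by blast+
    then show False
      using that(3) by simp
  qed
  have cover: "\<exists>X\<in>\<T>. e \<subseteq> X" if "e \<in> E" for e
  proof -
    have "card e = 2"
      using that assms by (simp add: simple_graph_def)
    \<comment> \<open>Were \<open>e\<close> in no tight set, it would be a new edge that could be
      added to \<open>F\<close>, against maximality.\<close>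
    then obtain X where X: "tight F X" "e \<subseteq> X"
      using laman_sparse_insert[OF F(2), of e] max[of "insert e F"] \<open>e \<in> E\<close> F(1) by blast
    then obtain Y where "X \<subseteq> Y" "Y \<in> \<T>"
      using finite_has_maximal2[of "{X. tight F X}" X] unfolding \<T>_def by auto
    then show ?thesis
      using X(2) by blast
  qed
  \<comment> \<open>Truncated subtraction is exact here, since each member has at least two
    vertices.\<close>
  have "(\<Sum>X\<in>\<T>. 2 * card X - 3) = (\<Sum>X\<in>\<T>. card (induced_edges F X))"
    by (rule sum.cong) (auto simp: \<T>_def tight_def)
  also have "\<dots> = card (\<Union>X\<in>\<T>. induced_edges F X)"
  proof (rule card_UN_disjoint[symmetric])
    show "\<forall>X\<in>\<T>. \<forall>Y\<in>\<T>. X \<noteq> Y \<longrightarrow> induced_edges F X \<inter> induced_edges F Y = {}"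
      using F(2) small by (simp add: laman_sparse_def induced_edges_disjoint)
  qed auto
  also have "\<dots> \<le> card F"
    by (rule card_mono) (auto simp: induced_edges_def)
  finally have "(\<Sum>X\<in>\<T>. 2 * card X - 3) \<le> card F" .
  moreover have "2 \<le> card X" if "X \<in> \<T>" for X
    using that by (simp add: \<T>_def tight_def)
  ultimately show thesis
    using that[of F \<T>] F small cover by blast
qed

section \<open>Discharging\<close>

definition inner_degree :: "'v set set \<Rightarrow> 'v set \<Rightarrow> 'v \<Rightarrow> nat"
  where "inner_degree E X v = card {e\<in>E. v \<in> e \<and> e \<subseteq> X}"

text \<open>These values make both the sum over the sets of a cover through a vertex at least \<open>16\<close> and the
  sum over the vertices of a proper subset \<open>X\<close> at most \<open>10 (2 |X| - 3)\<close>.\<close>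

definition charge :: "nat \<Rightarrow> nat"
  where "charge d = (if d = 0 then 0 else if d = 1 then 5 else if d = 2 then 10
    else if d = 3 then 11 else 16)"

lemma charge_mono: "c \<le> d \<Longrightarrow> charge c \<le> charge d"
  by (auto simp: charge_def)

lemma charge_le: "charge d \<le> 16"
  by (simp add: charge_def)

text \<open>For degrees up to \<open>4\<close>, only \<open>charge 3 = 11\<close> falls below
  \<open>4 * d\<close>. A part \<open>3\<close> of the total \<open>4\<close> forces another nonzero
  part, of charge at least \<open>5\<close>, and \<open>11 + 5 = 16\<close>.\<close>

lemma sum_charge_ge:
  fixes d :: "'a \<Rightarrow> nat"
  assumes "finite \<T>" "(\<Sum>X\<in>\<T>. d X) = 4"
  shows "16 \<le> (\<Sum>X\<in>\<T>. charge (d X))"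
proof (cases "\<exists>X\<in>\<T>. d X = 3")
  case True
  then obtain X where X: "X \<in> \<T>" "d X = 3" by blast
  then have "(\<Sum>Y\<in>\<T> - {X}. d Y) \<noteq> 0"
    using assms by (simp add: sum.remove)
  then obtain Y where Y: "Y \<in> \<T> - {X}" "d Y \<noteq> 0"
    by (meson sum.neutral)
  have "(\<Sum>Z\<in>{X, Y}. charge (d Z)) \<le> (\<Sum>Z\<in>\<T>. charge (d Z))"
    using X Y assms(1) by (intro sum_mono2) auto
  then show ?thesis
    using X Y charge_mono[of 1 "d Y"] by (auto simp: charge_def)
next
  case False
  have "d X \<le> 4" if "X \<in> \<T>" for X
    using member_le_sum[of X \<T> d] that assms by simp
  then have "4 * d X \<le> charge (d X)" if "X \<in> \<T>" for X
    using False that by (force simp: charge_def)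
  then have "(\<Sum>X\<in>\<T>. 4 * d X) \<le> (\<Sum>X\<in>\<T>. charge (d X))"
    by (rule sum_mono)
  then show ?thesis
    using assms(2) by (simp add: sum_distrib_left[symmetric])
qed

lemma inner_degree_eq:
  fixes E :: "'v::finite set set"
  assumes "simple_graph E" "v \<in> X"
  shows "inner_degree E X v = card {w\<in>X. {v, w} \<in> E}"
proof -
  have "simple_graph (induced_edges E X)"
    using assms(1) by (simp add: simple_graph_def induced_edges_def)
  moreover have "{e\<in>E. v \<in> e \<and> e \<subseteq> X} = {e\<in>induced_edges E X. v \<in> e}"
    by (auto simp: induced_edges_def)
  moreover have "{w\<in>X. {v, w} \<in> E} = {w. {v, w} \<in> induced_edges E X}"
    using assms(2) by (auto simp: induced_edges_def)
  ultimately show ?thesis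
    unfolding inner_degree_def by (simp only: card_star)
qed

lemma neighbours_subset:
  assumes "simple_graph E"
  shows "{w\<in>X. {v, w} \<in> E} \<subseteq> X - {v}"
  using simple_graph_irrefl[OF assms] by auto

lemma inner_degree_le_card:
  fixes E :: "'v::finite set set"
  assumes "simple_graph E" "v \<in> X"
  shows "inner_degree E X v \<le> card X - 1"
  using card_mono[OF _ neighbours_subset[OF assms(1), of X v]] assms(2)
  by (simp add: inner_degree_eq[OF assms])

lemma inner_degree_le_degree:
  fixes E :: "'v::finite set set"
  shows "inner_degree E X v \<le> vertex_degree E v"
  unfolding inner_degree_def vertex_degree_def by (rule card_mono) auto

lemma sum_inner_degree:
  fixes E :: "'v::finite set set"
  assumes "simple_graph E"
  shows "(\<Sum>v\<in>X. inner_degree E X v) = 2 * card (induced_edges E X)"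
proof -
  have "inner_degree E X v = card {e\<in>induced_edges E X. v \<in> e}" for v
    unfolding inner_degree_def induced_edges_def by (rule arg_cong[of _ _ card]) auto
  then show ?thesis
    using assms by (simp only:, intro handshake) (auto simp: induced_edges_def simple_graph_def)
qed

text \<open>If every vertex of \<open>X\<close> had all its edges inside, \<open>X\<close> would be
  closed under adjacency and hence contain every vertex.\<close>

lemma connected_ex_boundary_vertex:
  fixes E :: "'v::finite set set"
  assumes "connected_graph E" "X \<noteq> {}" "X \<noteq> UNIV"
  shows "\<exists>v\<in>X. inner_degree E X v < vertex_degree E v"
proof (rule ccontr)
  assume "\<not> ?thesis"
  then have ge: "vertex_degree E v \<le> inner_degree E X v" if "v \<in> X" for v
    using that by force
  have step: "w \<in> X" if "v \<in> X" "{v, w} \<in> E" for v w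
  proof -
    have "{e\<in>E. v \<in> e \<and> e \<subseteq> X} = {e\<in>E. v \<in> e}"
      using ge[OF that(1)] unfolding inner_degree_def vertex_degree_def
      by (intro card_seteq) auto
    moreover have "{v, w} \<in> {e\<in>E. v \<in> e}"
      using that(2) by simp
    ultimately have "{v, w} \<in> {e\<in>E. v \<in> e \<and> e \<subseteq> X}"
      by (simp only:)
    then show ?thesis
      by simp
  qed
  obtain u where "u \<in> X" using assms(2) by blast
  have "w \<in> X" for w
  proof -
    have "(u, w) \<in> {(a, b). {a, b} \<in> E}\<^sup>*"
      using assms(1) by (simp add: connected_graph_def)
    then show ?thesis
      by (induction rule: rtrancl_induct) (use \<open>u \<in> X\<close> step in auto)
  qed
  then show False
    using assms(3) by blast
qed

text \<open>The bound \<open>10 * (2 * card X - 3)\<close> without subtraction. At most four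
  vertices are handled by degrees at most \<open>card X - 1\<close>; beyond that, enough charge must
  be missing from \<open>16\<close> per vertex.\<close>

lemma sum_charge_inner_degree_le:
  fixes E :: "'v::finite set set"
  assumes "simple_graph E" "connected_graph E" "regular_graph E 4" "2 \<le> card X" "X \<noteq> UNIV"
  shows "(\<Sum>v\<in>X. charge (inner_degree E X v)) + 30 \<le> 20 * card X"
proof -
  let ?d = "inner_degree E X"
  have d4: "?d v \<le> 4" for v
    using inner_degree_le_degree[of E X v] assms(3) by (simp add: regular_graph_def)
  have "charge (?d v) \<le> charge (card X - 1)" if "v \<in> X" for v
    using inner_degree_le_card[OF assms(1) that] by (rule charge_mono)
  then have small: "(\<Sum>v\<in>X. charge (?d v)) \<le> card X * charge (card X - 1)"
    using sum_bounded_above[of X "\<lambda>v. charge (?d v)" "charge (card X - 1)"] by simp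
  have large: "(\<Sum>v\<in>Y. charge (?d v)) \<le> 16 * card Y" for Y
    using sum_bounded_above[of Y "\<lambda>v. charge (?d v)" 16] charge_le by (simp add: mult.commute)
  have "X \<noteq> {}"
    using assms(4) by auto
  then obtain u where u: "u \<in> X" "?d u < 4"
    using connected_ex_boundary_vertex[OF assms(2) _ assms(5)] assms(3)
    unfolding regular_graph_def by metis
  have remove: "(\<Sum>v\<in>X. f v) = f u + (\<Sum>v\<in>X - {u}. f v)" for f :: "'v \<Rightarrow> nat"
    using u(1) by (simp add: sum.remove)
  have cardu: "card (X - {u}) = card X - 1"
    using u(1) by simp
  show ?thesis
  proof (cases "card X \<le> 4")
    case True
    then have "card X = 2 \<or> card X = 3 \<or> card X = 4"
      using assms(4) by linarith
    then show ?thesis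
      using small by (auto simp: charge_def)
  next
    case gt: False
    show ?thesis
    proof (cases "\<exists>t\<in>X - {u}. ?d t < 4")
      case True
      \<comment> \<open>With two vertices of charge at most \<open>11\<close> and
        \<open>n = card X\<close>, the left side is at most \<open>22 + 16 * (n - 2) + 30\<close>,
        which is at most \<open>20 * n\<close> once \<open>5 \<le> n\<close>.\<close>
      then obtain t where t: "t \<in> X - {u}" "?d t < 4" by blast
      have "(\<Sum>v\<in>X - {u}. charge (?d v)) = charge (?d t) + (\<Sum>v\<in>X - {u} - {t}. charge (?d v))"
        using t(1) by (simp add: sum.remove)
      moreover have "card (X - {u} - {t}) = card X - 2"
        using t(1) cardu by simp
      moreover have "charge (?d u) \<le> 11" "charge (?d t) \<le> 11"
        using u(2) t(2) by (auto simp: charge_def)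
      ultimately show ?thesis
        using remove[of "\<lambda>v. charge (?d v)"] large[of "X - {u} - {t}"] gt by linarith
    next
      case False
      then have full: "?d t = 4" if "t \<in> X - {u}" for t
        using d4[of t] that by force
      \<comment> \<open>On five vertices the four full ones are adjacent to everything, including
        \<open>u\<close>, which would make \<open>u\<close> full as well.\<close>
      have "card X \<noteq> 5"
      proof
        assume card5: "card X = 5"
        have "X - {u} \<subseteq> {w\<in>X. {u, w} \<in> E}"
        proof
          fix t assume t: "t \<in> X - {u}"
          then have "card (X - {t}) = card {w\<in>X. {t, w} \<in> E}"
            using full[OF t] card5 by (simp add: inner_degree_eq[OF assms(1)])
          then have "{w\<in>X. {t, w} \<in> E} = X - {t}"
            using neighbours_subset[OF assms(1), of X t] by (intro card_subset_eq) auto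
          moreover have "u \<in> X - {t}"
            using t u(1) by blast
          ultimately have "{t, u} \<in> E"
            by blast
          then show "t \<in> {w\<in>X. {u, w} \<in> E}"
            using t by (simp add: insert_commute)
        qed
        then have "4 \<le> ?d u"
          using card_mono[of "{w\<in>X. {u, w} \<in> E}" "X - {u}"] u(1) card5
          by (simp add: inner_degree_eq[OF assms(1)])
        then show False
          using u(2) by simp
      qed
      \<comment> \<open>By parity \<open>u\<close> has degree at most \<open>2\<close> and charge at
        most \<open>10\<close>; now \<open>10 + 16 * (n - 1) + 30 \<le> 20 * n\<close> for
        \<open>n = card X\<close> at least \<open>6\<close>. Charge \<open>11\<close> would fail at
        \<open>n = 6\<close>.\<close>
      moreover have "even (?d u)"
      proof -
        have "?d u + 4 * (card X - 1) = 2 * card (induced_edges E X)"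
          using sum_inner_degree[OF assms(1), of X] remove[of ?d] full cardu by simp
        then show ?thesis
          by presburger
      qed
      then have "?d u \<noteq> 3"
        by auto
      then have "charge (?d u) \<le> 10"
        using u(2) by (auto simp: charge_def)
      ultimately show ?thesis
        using remove[of "\<lambda>v. charge (?d v)"] large[of "X - {u}"] cardu gt by linarith
    qed
  qed
qed

text \<open>Double counting of charge: at least \<open>16\<close> per vertex, at most
  \<open>10 * (2 * card X - 3)\<close> per set.\<close>

lemma sum_cover_ge:
  fixes E :: "'v::finite set set"
  assumes "simple_graph E" "connected_graph E" "regular_graph E 4"
    and "\<And>X. X \<in> \<T> \<Longrightarrow> 2 \<le> card X" "UNIV \<notin> \<T>"
    and "\<And>e. e \<in> E \<Longrightarrow> \<exists>X\<in>\<T>. e \<subseteq> X"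
    and "\<And>X Y. X \<in> \<T> \<Longrightarrow> Y \<in> \<T> \<Longrightarrow> X \<noteq> Y \<Longrightarrow> card (X \<inter> Y) < 2"
  shows "8 * CARD('v) \<le> 5 * (\<Sum>X\<in>\<T>. 2 * card X - 3)"
proof -
  let ?c = "\<lambda>X v. charge (inner_degree E X v)"
  \<comment> \<open>Each edge at \<open>v\<close> lies in exactly one member: the members cover the
    edges, and two of them share too few vertices to share an edge.\<close>
  have "(\<Sum>X\<in>\<T>. inner_degree E X v) = 4" for v
  proof -
    have "{e\<in>E. v \<in> e} = (\<Union>X\<in>\<T>. {e\<in>E. v \<in> e \<and> e \<subseteq> X})"
      using assms(6) by blast
    moreover have "card (\<Union>X\<in>\<T>. {e\<in>E. v \<in> e \<and> e \<subseteq> X}) = (\<Sum>X\<in>\<T>. card {e\<in>E. v \<in> e \<and> e \<subseteq> X})"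
    proof (rule card_UN_disjoint)
      show "\<forall>X\<in>\<T>. \<forall>Y\<in>\<T>. X \<noteq> Y \<longrightarrow> {e\<in>E. v \<in> e \<and> e \<subseteq> X} \<inter> {e\<in>E. v \<in> e \<and> e \<subseteq> Y} = {}"
        using induced_edges_disjoint[OF assms(1) assms(7)] unfolding induced_edges_def by blast
    qed auto
    ultimately show ?thesis
      using assms(3) unfolding inner_degree_def regular_graph_def vertex_degree_def by metis
  qed
  then have "16 \<le> (\<Sum>X\<in>\<T>. ?c X v)" for v
    by (intro sum_charge_ge) auto
  then have "16 * CARD('v) \<le> (\<Sum>v\<in>UNIV. \<Sum>X\<in>\<T>. ?c X v)"
    using sum_bounded_below[of UNIV 16 "\<lambda>v. \<Sum>X\<in>\<T>. ?c X v"] by (simp add: mult.commute)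
  also have "\<dots> = (\<Sum>X\<in>\<T>. \<Sum>v\<in>UNIV. ?c X v)"
    by (rule sum.swap)
  also have "\<dots> = (\<Sum>X\<in>\<T>. \<Sum>v\<in>X. ?c X v)"
  proof (rule sum.cong[OF refl])
    fix X assume "X \<in> \<T>"
    have "inner_degree E X v = 0" if "v \<notin> X" for v
      using that unfolding inner_degree_def by (auto simp: card_eq_0_iff)
    then show "(\<Sum>v\<in>UNIV. ?c X v) = (\<Sum>v\<in>X. ?c X v)"
      by (intro sum.mono_neutral_right) (auto simp: charge_def)
  qed
  also have "\<dots> \<le> (\<Sum>X\<in>\<T>. 10 * (2 * card X - 3))"
  proof (rule sum_mono)
    fix X assume X: "X \<in> \<T>"
    then have "X \<noteq> UNIV" using assms(5) by blast
    then show "(\<Sum>v\<in>X. ?c X v) \<le> 10 * (2 * card X - 3)"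
      using sum_charge_inner_degree_le[OF assms(1-3) assms(4)[OF X]] by linarith
  qed
  also have "\<dots> = 10 * (\<Sum>X\<in>\<T>. 2 * card X - 3)"
    by (simp only: sum_distrib_left)
  finally show ?thesis
    by linarith
qed

lemma regular_card_gt:
  fixes E :: "'v::finite set set"
  assumes "simple_graph E" "regular_graph E k"
  shows "k < CARD('v)"
proof -
  obtain v :: 'v where True by blast
  have "{a. {v, a} \<in> E} \<subset> UNIV"
    using simple_graph_irrefl[OF assms(1), of v] by blast
  then have "card {a. {v, a} \<in> E} < CARD('v)"
    by (intro psubset_card_mono) auto
  then show ?thesis
    using assms(2) card_star[OF assms(1), of v] by (simp add: regular_graph_def vertex_degree_def)
qed

theorem theorem1:
  fixes E :: "'v::finite set set"
  assumes "simple_graph E"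
    and "connected_graph E"
    and "regular_graph E 4"
  shows "real (generic_rank E) \<ge> 8 / 5 * real CARD('v) - 1"
proof -
  obtain F \<T> where F: "F \<subseteq> E" "laman_sparse F" and \<T>: "\<And>X. X \<in> \<T> \<Longrightarrow> 2 \<le> card X"
    "\<And>e. e \<in> E \<Longrightarrow> \<exists>X\<in>\<T>. e \<subseteq> X"
    "\<And>X Y. X \<in> \<T> \<Longrightarrow> Y \<in> \<T> \<Longrightarrow> X \<noteq> Y \<Longrightarrow> card (X \<inter> Y) < 2"
    and sum: "(\<Sum>X\<in>\<T>. 2 * card X - 3) \<le> card F"
    using ex_tight_cover[OF assms(1)] by blast
  \<comment> \<open>The \<open>+ 5\<close> is the \<open>- 1\<close> of the claim scaled by
    \<open>5\<close>. It matters only if \<open>UNIV\<close> is a member, where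
    \<open>8 * n \<le> 5 * (2 * n - 3) + 5\<close> is equivalent to
    \<open>5 \<le> n\<close>.\<close>
  have "8 * CARD('v) \<le> 5 * (\<Sum>X\<in>\<T>. 2 * card X - 3) + 5"
  proof (cases "UNIV \<in> \<T>")
    case True
    have "2 * CARD('v) - 3 \<le> (\<Sum>X\<in>\<T>. 2 * card X - 3)"
      using member_le_sum[OF True, of "\<lambda>X. 2 * card X - 3"] by simp
    then show ?thesis
      using regular_card_gt[OF assms(1,3)] by linarith
  next
    case False
    then show ?thesis
      using sum_cover_ge[OF assms \<T>(1) False \<T>(2,3)] by linarith
  qed
  moreover have "card F \<le> generic_rank E"
    unfolding generic_rank_def
    using edge_independent_imp_le_rigidity_rank[OF _ F(1) assms(1)]
      laman_sparse_imp_edge_independent[OF _ F(2)] someI_ex[OF ex_generic] by blast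
  ultimately have "8 * CARD('v) \<le> 5 * generic_rank E + 5"
    using sum by linarith
  then show ?thesis
    by linarith
qed

end
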